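(* Let $f \in \mathcal{S}^{*}$ have Taylor expansion $f(z) = z + \sum_{n=2}^{\infty} a_n z^n$ for $z \in \mathbb{D}$, and let $f^{-1}(w) = w + A_2 w^2 + A_3 w^3 + \cdots$ be the expansion of its local inverse near the origin. Then $$\bigl| H(3,1)(f^{-1}) \bigr| \le 1 .$$ The inequality is sharp: equality is attained for the Koebe function $k(z) = \dfrac{z}{(1-z)^2}$, $z \in \mathbb{D}$.
   Context: Let $\mathbb{D} = \{z \in \mathbb{C} : |z| < 1\}$. Let $\mathcal{A}$ be the class of analytic functions $f$ on $\mathbb{D}$ normalized by $f(0)=0$ and $f'(0)=1$, i.e. with Taylor expansion $f(z) = z + \sum_{n=2}^{\infty} a_n z^n$. The class of starlike functions is $$\mathcal{S}^{*} = \left\{ f \in \mathcal{A} : \operatorname{Re}\left( \frac{z f'(z)}{f(z)} \right) > 0 \text{ for all } z \in \mathbb{D} \right\},$$ where the quotient $z f'(z)/f(z)$ is understood to take the value $1$ at $z = 0$ (removable singularity). Functions in $\mathcal{S}^{*}$ are univalent (one-to-one) on $\mathbb{D}$. Each $f \in \mathcal{S}^{*}$ has a local analytic inverse $f^{-1}$ defined in a neighborhood of $0$, with $f(f^{-1}(w)) = w$, and expansion $f^{-1}(w) = w + A_2 w^2 + A_3 w^3 + \cdots$. For a normalized power series $g(w) = w + \sum_{n\ge 2} b_n w^n$ (so $b_1 = 1$) and $n, q \in \mathbb{N}$, the $q$th Hankel determinant $H(q,n)(g)$ is the determinant of the $q \times q$ matrix whose $(i,j)$ entry is $b_{n+i+j-2}$,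 $1 \le i,j \le q$. In particular, with $A_1 = 1$, $$H(3,1)(f^{-1}) = \begin{vmatrix} 1 & A_2 & A_3 \\ A_2 & A_3 & A_4 \\ A_3 & A_4 & A_5 \end{vmatrix} = 2A_2A_3A_4 - A_3^3 - A_4^2 + A_3A_5 - A_2^2A_5 .$$ *)

theory Defs
  imports "HOL-Complex_Analysis.Complex_Analysis" "Jordan_Normal_Form.Determinant"
begin

hide_const (open) Finite_Cartesian_Product.mat Determinants.det

definition normalized_analytic :: "(complex \<Rightarrow> complex) set" where
  "normalized_analytic = {f. f holomorphic_on ball 0 1 \<and> f 0 = 0 \<and> deriv f 0 = 1}"

text \<open>The quotient is given the value 1 at its removable singularity 0. If f has a further
  zero z in the disc, then \<open>z f'(z) / f(z)\<close> has a pole there; HOL division by zero gives it the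
  value 0, whose real part is not positive, so such f are excluded, as they should be.\<close>

definition starlike_functions :: "(complex \<Rightarrow> complex) set" where
  "starlike_functions = {f \<in> normalized_analytic.
     \<forall>z\<in>ball 0 1. Re (if z = 0 then 1 else z * deriv f z / f z) > 0}"

text \<open>g is a local analytic inverse of f at 0. Only its germ at 0 is constrained, and hence (for
  f normalized) determined; the values of g away from 0 are irrelevant.\<close>

definition local_inverse :: "(complex \<Rightarrow> complex) \<Rightarrow> (complex \<Rightarrow> complex) \<Rightarrow> bool" where
  "local_inverse f g \<longleftrightarrow>
     g analytic_on {0} \<and> g 0 = 0 \<and> eventually (\<lambda>w. f (g w) = w) (nhds 0)"

text \<open>Matrix indices start at 0 here, so the entry \<open>b\<^bsub>n+i+j-2\<^esub>\<close> with \<open>1 \<le> i, j \<le> q\<close> becomes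
  \<open>b\<^bsub>n+i+j\<^esub>\<close> with \<open>i, j < q\<close>.\<close>

definition hankel_det :: "nat \<Rightarrow> nat \<Rightarrow> complex fps \<Rightarrow> complex" where
  "hankel_det q n G = det (mat q q (\<lambda>(i, j). fps_nth G (n + i + j)))"

definition koebe :: "complex \<Rightarrow> complex" where
  "koebe z = z / (1 - z)\<^sup>2"

lemma local_inverse_exists:
  assumes "f \<in> normalized_analytic"
  shows "\<exists>g. local_inverse f g"
proof -
  have holf: "f holomorphic_on ball 0 1" and f0: "f 0 = 0" and d: "deriv f 0 \<noteq> 0"
    using assms by (auto simp: normalized_analytic_def)
  obtain r where r: "r > 0" "ball 0 r \<subseteq> ball (0::complex) 1" "open (f ` ball 0 r)" "inj_on f (ball 0 r)"
    by (rule has_complex_derivative_locally_invertible[OF holf _ open_ball d]) (simp, blast)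
  have hol: "f holomorphic_on ball 0 r"
    using holf r(2) by (rule holomorphic_on_subset)
  obtain g where g: "g holomorphic_on (f ` ball 0 r)"
      "\<And>z. z \<in> ball 0 r \<Longrightarrow> deriv f z * deriv g (f z) = 1"
      "\<And>z. z \<in> ball 0 r \<Longrightarrow> g (f z) = z"
    using holomorphic_has_inverse[OF hol open_ball r(4)] by metis
  have 0: "0 \<in> f ` ball 0 r"
    using r(1) f0 by (metis centre_in_ball image_eqI)
  have "g analytic_on {0}"
    using g(1) r(3) 0 analytic_at by blast
  moreover have "g 0 = 0"
    using g(3)[of 0] r(1) f0 by simp
  moreover have "eventually (\<lambda>w. f (g w) = w) (nhds 0)"
    using eventually_nhds_in_open[OF r(3) 0] by eventually_elim (auto simp: g(3))
  ultimately show ?thesis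
    unfolding local_inverse_def by blast
qed

end

theory Submission
  imports Defs
begin

text \<open>
  Let \<open>p(z) = z f'(z) / f(z)\<close> for a starlike \<open>f\<close>. Comparing coefficients first in \<open>z f' = p f\<close> and then
  in \<open>f(g(w)) = w\<close> expresses the Hankel determinant of the inverse \<open>g\<close> as a polynomial in the
  Taylor coefficients \<open>p\<^sub>1, \<dots>, p\<^sub>4\<close> of \<open>p\<close> (\<open>hankel_det_inverse\<close>). Since \<open>Re p > 0\<close>, one can write
  \<open>p = (1 + z w) / (1 - z w)\<close> with \<open>\<bar>w\<bar> \<le> 1\<close> on the disc, and three steps of Schur's algorithm express the
  coefficients of \<open>w\<close>, hence those of \<open>p\<close>, by four free parameters \<open>c, x, y, u\<close> in the closed unit
  disc (\<open>schur_parameters\<close>).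

  Put \<open>s = \<bar>c\<bar>\<^sup>2\<close>, \<open>t = 1 - s\<close>, \<open>r = \<bar>x\<bar>\<close>. In these parameters the determinant is
  \<open>H\<^sub>0(c, x) + (1 - r\<^sup>2) t M\<close> (\<open>hankel_schur\<close>), where \<open>M\<close> collects the terms with \<open>y\<close> and \<open>u\<close>. The
  value 1 is attained not only at the Koebe function (\<open>s = 1\<close>) but for all real \<open>c\<close> with \<open>x = -1\<close>,
  so no estimate may lose anything there. The factor \<open>1 - r\<^sup>2\<close> removes \<open>M\<close> on this set, and the
  triangle inequality is good enough for \<open>M\<close>. In \<open>H\<^sub>0\<close> it gives, for \<open>c \<ge> 0\<close>, the value at \<open>x = -r\<close>,
  except for three terms that form a quadratic form in \<open>c\<^sup>2\<close> and \<open>x\<close>, one of whose coefficients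
  changes sign at \<open>6 s = 43 t\<close>. For this form \<open>quadratic_form_bound\<close> supplies the value at \<open>x = -r\<close>.
  What remains is a polynomial inequality in \<open>\<bar>c\<bar>\<close> and \<open>r\<close> (\<open>hankel_majorant_le_1\<close>). Once \<open>\<bar>c\<bar>\<close>
  is replaced by \<open>(1 + s) / 2\<close> where it occurs to an odd power, the difference of the two sides is
  \<open>t (1 - r)\<close> times a polynomial with nonnegative coefficients in the Bernstein basis of the unit square.
\<close>

section \<open>Inequalities\<close>

text \<open>The majorant that the triangle inequality produces, with \<open>a = \<bar>c\<bar>\<close>. It equals 1 on the whole
  edge \<open>r = 1\<close>; the cofactor of \<open>t (1 - r)\<close> in the difference is shown to be nonnegative.\<close>

lemma hankel_majorant_le_1:
  fixes a r :: real
  assumes a: "0 \<le> a" "a \<le> 1" and r: "0 \<le> r" "r \<le> 1"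
  defines "s \<equiv> a\<^sup>2"
  defines "t \<equiv> 1 - s"
  shows "s * (s\<^sup>2 + 17/6 * t * s * r - t * (6 * s - 43 * t) / 18 * r\<^sup>2)
     + t * (18 * t\<^sup>2 + 10 * s * t + 9 * s\<^sup>2) / 18 * r^3 + s * t\<^sup>2 / 18 * r^4
     + (1 - r\<^sup>2) * t * (a * (r * (5 * t + 9 * s) + t * r\<^sup>2 + 3 * s) / 9 + 1/2) \<le> 1"
proof -
  have s: "0 \<le> s" "s \<le> 1" and t: "0 \<le> t"
    using a by (auto simp: s_def t_def power_le_one)
  \<comment> \<open>This makes the inequality polynomial in \<open>s\<close>. The cofactor vanishes at \<open>s = r = 1\<close>, so the bound
    has to be exact at \<open>s = 1\<close>.\<close>
  have as: "a \<le> (1 + s) / 2"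
    using zero_le_power2[of "a - 1"] by (simp add: s_def power2_eq_square algebra_simps)
  define q where "q = 1 - r"
  have q: "0 \<le> q" using r by (simp add: q_def)
  \<comment> \<open>Bernstein form of degree 2 in \<open>s\<close> and 3 in \<open>r\<close>\<close>
  define D where "D = t\<^sup>2 * (9 * q^3 + 31 * q\<^sup>2 * r + 47 * q * r\<^sup>2 + 24 * r^3)
    + s * t * (33 * q^3 + 113 * q\<^sup>2 * r + 117 * q * r\<^sup>2 + 36 * r^3)
    + s\<^sup>2 * (39 * q^3 + 87 * q\<^sup>2 * r + 48 * q * r\<^sup>2)"
  have D: "D \<ge> 0"
    unfolding D_def using s t q r by (intro add_nonneg_nonneg mult_nonneg_nonneg) auto
  have "(1 - r\<^sup>2) * t * (a * (r * (5 * t + 9 * s) + t * r\<^sup>2 + 3 * s) / 9 + 1/2)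
      \<le> (1 - r\<^sup>2) * t * ((1 + s) / 2 * (r * (5 * t + 9 * s) + t * r\<^sup>2 + 3 * s) / 9 + 1/2)"
    using s t r as
    by (intro mult_left_mono add_right_mono divide_right_mono mult_right_mono) (auto simp: power_le_one)
  moreover have "1 - (s * (s\<^sup>2 + 17/6 * t * s * r - t * (6 * s - 43 * t) / 18 * r\<^sup>2)
     + t * (18 * t\<^sup>2 + 10 * s * t + 9 * s\<^sup>2) / 18 * r^3 + s * t\<^sup>2 / 18 * r^4
     + (1 - r\<^sup>2) * t * ((1 + s) / 2 * (r * (5 * t + 9 * s) + t * r\<^sup>2 + 3 * s) / 9 + 1/2))
     = t * q * D / 18"
    unfolding D_def q_def t_def by (simp add: field_simps power2_eq_square power3_eq_cube power4_eq_xxxx)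
  moreover have "t * q * D / 18 \<ge> 0" using t q D by simp
  ultimately show ?thesis by linarith
qed

text \<open>For given \<open>\<bar>v\<bar>\<close> and \<open>\<bar>x\<bar>\<close> the squared modulus of the form is a quadratic polynomial in
  \<open>m = Re (v * cnj x)\<close>. The hypothesis \<open>dom\<close> makes its value at \<open>m = - \<bar>v\<bar> \<bar>x\<bar>\<close>, that is, at \<open>x\<close>
  pointing in the direction of \<open>- v\<close>, the largest one. For \<open>k > 0\<close> the triangle inequality would
  only give \<open>+ k \<bar>x\<bar>\<^sup>2\<close> in place of \<open>- k \<bar>x\<bar>\<^sup>2\<close>.\<close>

lemma quadratic_form_bound:
  fixes v x :: complex and b k :: real
  assumes b: "0 \<le> b" and nn: "k * (cmod x)\<^sup>2 \<le> (cmod v)\<^sup>2"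
    and dom: "4 * k * cmod v * cmod x \<le> b * ((cmod v)\<^sup>2 - k * (cmod x)\<^sup>2)"
  shows "cmod (v\<^sup>2 - b * v * x - k * x\<^sup>2) \<le> (cmod v)\<^sup>2 + b * cmod v * cmod x - k * (cmod x)\<^sup>2"
proof (rule power2_le_imp_le)
  define m where "m = Re (v * cnj x)"
  define S R where "S = cmod v" and "R = cmod x"
  have m: "\<bar>m\<bar> \<le> S * R"
    unfolding m_def S_def R_def using abs_Re_le_cmod[of "v * cnj x"] by (simp add: norm_mult)
  have "0 \<le> b * (S\<^sup>2 - k * R\<^sup>2) - 2 * k * (S * R - m)"
  proof (cases "k \<ge> 0")
    case True
    have "S * R - m \<le> 2 * (S * R)"
      using m by linarith
    then have "2 * k * (S * R - m) \<le> 2 * k * (2 * (S * R))"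
      using True by (intro mult_left_mono) auto
    then show ?thesis using dom by (simp add: S_def R_def algebra_simps)
  next
    case False
    have "k * (S * R - m) \<le> 0"
      using False m by (intro mult_nonpos_nonneg) linarith+
    then have "2 * k * (S * R - m) \<le> 0" by linarith
    moreover have "b * (S\<^sup>2 - k * R\<^sup>2) \<ge> 0"
      using b nn by (simp add: S_def R_def)
    ultimately show ?thesis by linarith
  qed
  then have "0 \<le> 2 * (m + S * R) * (b * (S\<^sup>2 - k * R\<^sup>2) - 2 * k * (S * R - m))"
    using m by (intro mult_nonneg_nonneg) auto
  also have "\<dots> = (S\<^sup>2 + b * S * R - k * R\<^sup>2)\<^sup>2 - (cmod (v\<^sup>2 - b * v * x - k * x\<^sup>2))\<^sup>2"
  proof -
    have S2: "S\<^sup>2 = (Re v)\<^sup>2 + (Im v)\<^sup>2" and R2: "R\<^sup>2 = (Re x)\<^sup>2 + (Im x)\<^sup>2"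
      and m_eq: "m = Re v * Re x + Im v * Im x"
      by (auto simp: S_def R_def m_def cmod_power2)
    have "(cmod (v\<^sup>2 - b * v * x - k * x\<^sup>2))\<^sup>2
       = (S\<^sup>2)\<^sup>2 + b\<^sup>2 * S\<^sup>2 * R\<^sup>2 + k\<^sup>2 * (R\<^sup>2)\<^sup>2 - 2 * b * S\<^sup>2 * m - 2 * k * (2 * m\<^sup>2 - S\<^sup>2 * R\<^sup>2)
         + 2 * b * k * R\<^sup>2 * m"
      unfolding S2 R2 m_eq cmod_power2 by (simp add: power2_eq_square algebra_simps)
    then show ?thesis by (simp add: power2_eq_square algebra_simps)
  qed
  finally show "(cmod (v\<^sup>2 - b * v * x - k * x\<^sup>2))\<^sup>2
      \<le> ((cmod v)\<^sup>2 + b * cmod v * cmod x - k * (cmod x)\<^sup>2)\<^sup>2"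
    by (simp add: S_def R_def)
  show "0 \<le> (cmod v)\<^sup>2 + b * cmod v * cmod x - k * (cmod x)\<^sup>2"
    using nn b by (simp add: add_increasing2)
qed

section \<open>The determinant in Schur parameters\<close>

text \<open>The third Hankel determinant of the inverse of \<open>f\<close> as a function of the first four
  coefficients of \<open>z f'(z) / f(z)\<close>; see \<open>hankel_det_inverse\<close>.\<close>

definition hankel_from_quotient :: "complex \<Rightarrow> complex \<Rightarrow> complex \<Rightarrow> complex \<Rightarrow> complex" where
  "hankel_from_quotient p1 p2 p3 p4 =
     (17 * p1^6 - 51 * p1^4 * p2 + 8 * p1^3 * p3 + 45 * p1\<^sup>2 * p2\<^sup>2 - 18 * p1\<^sup>2 * p4
        - 27 * p2^3 + 24 * p1 * p2 * p3 + 18 * p2 * p4 - 16 * p3\<^sup>2) / 144"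

text \<open>A polynomial identity, in which \<open>C, X, Y\<close> stand for the conjugates of \<open>c, x, y\<close>. The
  arguments on the left are the coefficients of \<open>p\<close> that \<open>schur_parameters\<close> and
  \<open>caratheodory_coeffs\<close> provide.\<close>

lemma hankel_schur:
  fixes c x y u C X Y :: complex
  defines "s \<equiv> c * C" and "t \<equiv> 1 - c * C" and "e \<equiv> 1 - x * X" and "g \<equiv> 1 - y * Y"
  defines "w1 \<equiv> t * x" and "w2 \<equiv> t * (e * y - C * x\<^sup>2)"
    and "w3 \<equiv> t * (e * (g * u - X * y\<^sup>2 - 2 * C * x * y) + C\<^sup>2 * x^3)"
  shows "hankel_from_quotient (2 * c) (2 * (w1 + c\<^sup>2)) (2 * (w2 + 2 * c * w1 + c^3))
       (2 * (w3 + 2 * c * w2 + w1\<^sup>2 + 3 * c\<^sup>2 * w1 + c^4)) =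
     c\<^sup>2 * ((c\<^sup>2)\<^sup>2 - 17/6 * t * c\<^sup>2 * x - t * (6 * s - 43 * t) / 18 * x\<^sup>2)
     - t * (18 * t\<^sup>2 + 10 * s * t + 9 * s\<^sup>2) / 18 * x^3 + C\<^sup>2 * t\<^sup>2 / 18 * x^4
     + e * t * ((c * x * (5 * t + 9 * s) - t * C * x\<^sup>2 + 3 * c^3) / 9 * y
         + (- (t * (8 + x * X) / 18) + c\<^sup>2 * X / 2) * y\<^sup>2 + (t * x - c\<^sup>2) / 2 * g * u)"
  unfolding hankel_from_quotient_def assms
  by (simp add: field_simps eval_nat_numeral)

text \<open>Here \<open>Q\<close> is the quadratic form in \<open>c\<^sup>2\<close> and \<open>x\<close>. In \<open>M\<close> the coefficients of \<open>y\<^sup>2\<close> and of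
  \<open>(1 - \<bar>y\<bar>\<^sup>2) u\<close> are both at most 1/2 in modulus, so that these two terms together contribute at most 1/2.\<close>

lemma hankel_schur_bound:
  fixes c x y u :: complex
  assumes c: "cmod c \<le> 1" and x: "cmod x \<le> 1" and y: "cmod y \<le> 1" and u: "cmod u \<le> 1"
  defines "t \<equiv> 1 - c * cnj c" and "e \<equiv> 1 - x * cnj x" and "g \<equiv> 1 - y * cnj y"
  defines "w1 \<equiv> t * x" and "w2 \<equiv> t * (e * y - cnj c * x\<^sup>2)"
    and "w3 \<equiv> t * (e * (g * u - cnj x * y\<^sup>2 - 2 * cnj c * x * y) + (cnj c)\<^sup>2 * x^3)"
  shows "cmod (hankel_from_quotient (2 * c) (2 * (w1 + c\<^sup>2)) (2 * (w2 + 2 * c * w1 + c^3))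
       (2 * (w3 + 2 * c * w2 + w1\<^sup>2 + 3 * c\<^sup>2 * w1 + c^4))) \<le> 1" (is "cmod ?H \<le> 1")
proof -
  define a r q where "a = cmod c" and "r = cmod x" and "q = cmod y"
  define s T where "s = a\<^sup>2" and "T = 1 - a\<^sup>2"
  define k where "k = T * (6 * s - 43 * T) / 18"
  have a: "0 \<le> a" "a \<le> 1" and r: "0 \<le> r" "r \<le> 1" and q: "0 \<le> q" "q \<le> 1"
    using c x y by (auto simp: a_def r_def q_def)
  have s: "0 \<le> s" "s \<le> 1" and T: "0 \<le> T" "T \<le> 1" and sT: "s + T = 1"
    and r2: "0 \<le> r\<^sup>2" "r\<^sup>2 \<le> 1" and q2: "0 \<le> q\<^sup>2" "q\<^sup>2 \<le> 1"
    using a r q by (auto simp: s_def T_def power_le_one)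
  have cc: "c * cnj c = of_real s" and xx: "x * cnj x = of_real (r\<^sup>2)" and yy: "y * cnj y = of_real (q\<^sup>2)"
    by (simp_all add: s_def a_def r_def q_def flip: complex_norm_square)
  have t_eq: "t = of_real T" and e_eq: "e = of_real (1 - r\<^sup>2)" and g_eq: "g = of_real (1 - q\<^sup>2)"
    by (simp_all add: t_def e_def g_def cc xx yy T_def s_def)
  define Q where "Q = (c\<^sup>2)\<^sup>2 - of_real (17/6 * T) * c\<^sup>2 * x - of_real k * x\<^sup>2"
  define A where "A = T * (18*T\<^sup>2 + 10 * s*T + 9 * s\<^sup>2) / 18"
  define B where "B = T\<^sup>2 / 18"
  define M1 where "M1 = c * x * of_real (5*T + 9 * s) - of_real T * cnj c * x\<^sup>2 + 3 * c^3"
  define M2 where "M2 = c\<^sup>2 * cnj x / 2 - of_real (T * (8 + r\<^sup>2) / 18)"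
  define M3 where "M3 = (of_real T * x - c\<^sup>2) / 2"
  define M where "M = M1 / 9 * y + M2 * y\<^sup>2 + M3 * of_real (1 - q\<^sup>2) * u"
  have H: "?H = c\<^sup>2 * Q - of_real A * x^3 + of_real B * ((cnj c)\<^sup>2 * x^4) + of_real ((1 - r\<^sup>2) * T) * M"
  proof -
    have "?H = c\<^sup>2 * ((c\<^sup>2)\<^sup>2 - 17/6 * t * c\<^sup>2 * x - t * (6 * (c * cnj c) - 43*t) / 18 * x\<^sup>2)
     - t * (18*t\<^sup>2 + 10 * (c * cnj c) * t + 9 * (c * cnj c)\<^sup>2) / 18 * x^3 + (cnj c)\<^sup>2 * t\<^sup>2 / 18 * x^4
     + e * t * ((c * x * (5*t + 9 * (c * cnj c)) - t * cnj c * x\<^sup>2 + 3 * c^3) / 9 * y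
         + (- (t * (8 + x * cnj x) / 18) + c\<^sup>2 * cnj x / 2) * y\<^sup>2 + (t * x - c\<^sup>2) / 2 * g * u)"
      unfolding w3_def w2_def w1_def t_def e_def g_def by (rule hankel_schur)
    also have "\<dots> = c\<^sup>2 * Q - of_real A * x^3 + of_real B * ((cnj c)\<^sup>2 * x^4) + of_real ((1 - r\<^sup>2) * T) * M"
      unfolding cc xx t_eq e_eq g_eq Q_def A_def B_def M_def M1_def M2_def M3_def k_def
      by (simp add: field_simps)
    finally show ?thesis .
  qed
  have AB: "0 \<le> A" "0 \<le> B"
    using s T by (auto simp: A_def B_def)
  have Q: "cmod Q \<le> s\<^sup>2 + 17/6 * T * s * r - k * r\<^sup>2"
  proof -
    have nc: "cmod (c\<^sup>2) = s" by (simp add: norm_power s_def a_def)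
    \<comment> \<open>Only \<open>k > 0\<close> is critical, and this forces \<open>T\<close> to be at most \<open>6 s / 43\<close>.\<close>
    have k: "k * r\<^sup>2 \<le> s\<^sup>2 / 3 \<and> k * r \<le> T * s / 3"
    proof (cases "6 * s \<le> 43 * T")
      case True
      then have "k \<le> 0" using T by (simp add: k_def mult_nonneg_nonpos)
      then have "k * r\<^sup>2 \<le> 0" "k * r \<le> 0" using r by (auto intro: mult_nonpos_nonneg)
      moreover have "0 \<le> s\<^sup>2 / 3" "0 \<le> T * s / 3" using s T by auto
      ultimately show ?thesis by linarith
    next
      case False
      then have k0: "0 \<le> k" using T by (simp add: k_def)
      have kT: "k \<le> T * s / 3"
        using mult_nonneg_nonneg[OF T(1) T(1)] by (simp add: k_def field_simps)
      have "T * s \<le> s * s" using False s T by (intro mult_right_mono) auto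
      then have "k \<le> s\<^sup>2 / 3" using kT by (simp add: power2_eq_square)
      moreover have "k * r\<^sup>2 \<le> k" "k * r \<le> k" using k0 r r2 by (auto intro: mult_left_le)
      ultimately show ?thesis using kT by linarith
    qed
    have "s * (k * r) \<le> s * (T * s / 3)" using k s by (intro mult_left_mono) auto
    then have "4 * k * s * r \<le> 4/3 * T * s\<^sup>2" by (simp add: power2_eq_square mult_ac)
    also have "\<dots> \<le> 17/6 * T * (2/3 * s\<^sup>2)" using T by (simp add: mult_right_mono)
    also have "\<dots> \<le> 17/6 * T * (s\<^sup>2 - k * r\<^sup>2)" using k T by (intro mult_left_mono) auto
    finally have dom: "4 * k * s * r \<le> 17/6 * T * (s\<^sup>2 - k * r\<^sup>2)" .
    have "k * r\<^sup>2 \<le> s\<^sup>2" using k zero_le_power2[of s] by linarith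
    then show ?thesis
      using quadratic_form_bound[of "17/6 * T" k x "c\<^sup>2"] T dom unfolding nc Q_def r_def by simp
  qed
  have M: "cmod M \<le> a * (r*(5*T + 9 * s) + T*r\<^sup>2 + 3 * s) / 9 + 1/2"
  proof -
    have "cmod M1 \<le> cmod (c * x * of_real (5*T + 9 * s)) + cmod (of_real T * cnj c * x\<^sup>2) + cmod (3 * c^3)"
      unfolding M1_def by (intro order_trans[OF norm_triangle_ineq] add_mono norm_triangle_ineq4 order_refl)
    also have "\<dots> = a * (r*(5*T + 9 * s) + T*r\<^sup>2 + 3 * s)"
      using T s by (simp add: norm_mult norm_power a_def[symmetric] r_def[symmetric] s_def
          power2_eq_square power3_eq_cube algebra_simps del: of_real_add of_real_mult)
    finally have M1: "cmod M1 \<le> a * (r*(5*T + 9 * s) + T*r\<^sup>2 + 3 * s)" .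
    have "cmod M2 \<le> cmod (c\<^sup>2 * cnj x / 2) + cmod (of_real (T * (8 + r\<^sup>2) / 18))"
      unfolding M2_def by (rule norm_triangle_ineq4)
    also have "\<dots> = s * r / 2 + T * (8 + r\<^sup>2) / 18"
      using T r2 by (simp add: norm_mult norm_divide norm_power a_def[symmetric] r_def[symmetric]
          s_def del: of_real_add of_real_mult of_real_divide)
    also have "\<dots> \<le> s * 1 / 2 + T * (8 + 1) / 18"
      using s T r r2 by (intro add_mono divide_right_mono mult_left_mono) auto
    also have "\<dots> = 1/2" using sT by simp
    finally have M2: "cmod M2 \<le> 1/2" .
    have "cmod (of_real T * x - c\<^sup>2) \<le> cmod (of_real T * x) + cmod (c\<^sup>2)"
      by (rule norm_triangle_ineq4)
    also have "\<dots> = T * r + s"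
      using T by (simp add: norm_mult norm_power a_def[symmetric] r_def[symmetric] s_def)
    also have "\<dots> \<le> T * 1 + s" using T r by (intro add_mono mult_left_mono) auto
    finally have M3: "cmod M3 \<le> 1/2" using sT by (simp add: M3_def norm_divide)
    have "cmod M \<le> cmod (M1 / 9 * y) + cmod (M2 * y\<^sup>2) + cmod (M3 * of_real (1 - q\<^sup>2) * u)"
      unfolding M_def by (intro order_trans[OF norm_triangle_ineq] add_mono norm_triangle_ineq order_refl)
    also have "\<dots> = cmod M1 / 9 * q + cmod M2 * q\<^sup>2 + cmod M3 * (1 - q\<^sup>2) * cmod u"
      using q2 by (simp add: norm_mult norm_divide norm_power q_def[symmetric] del: of_real_diff)
    also have "\<dots> \<le> cmod M1 / 9 * 1 + 1/2 * q\<^sup>2 + 1/2 * (1 - q\<^sup>2) * 1"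
      using q q2 u M2 M3 by (intro add_mono mult_mono mult_left_mono mult_right_mono) auto
    also have "\<dots> = cmod M1 / 9 + 1/2" by (simp add: field_simps)
    also have "\<dots> \<le> a * (r*(5*T + 9 * s) + T*r\<^sup>2 + 3 * s) / 9 + 1/2" using M1 by simp
    finally show ?thesis .
  qed
  have "cmod ?H \<le> cmod (c\<^sup>2 * Q) + cmod (of_real A * x^3) + cmod (of_real B * ((cnj c)\<^sup>2 * x^4))
      + cmod (of_real ((1 - r\<^sup>2) * T) * M)"
    unfolding H by (intro order_trans[OF norm_triangle_ineq] add_mono norm_triangle_ineq4 norm_triangle_ineq order_refl)
  also have "\<dots> = s * cmod Q + A * r^3 + B * (s * r^4) + (1 - r\<^sup>2) * T * cmod M"
    using AB T r2 by (simp add: norm_mult norm_power abs_mult a_def[symmetric] r_def[symmetric] s_def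
        del: of_real_mult of_real_diff)
  also have "\<dots> \<le> s * (s\<^sup>2 + 17/6 * T * s * r - k * r\<^sup>2) + A * r^3 + B * (s * r^4)
      + (1 - r\<^sup>2) * T * (a * (r*(5*T + 9 * s) + T*r\<^sup>2 + 3 * s) / 9 + 1/2)"
    using Q M s T r2 by (intro add_mono mult_left_mono order_refl) auto
  also have "\<dots> \<le> 1"
    using hankel_majorant_le_1[OF a r] unfolding k_def A_def B_def s_def T_def by (simp add: mult_ac)
  finally show ?thesis .
qed

section \<open>Bounded functions and their Schur parameters\<close>

lemma schwarz_quotient:
  assumes "f holomorphic_on ball 0 1" "f 0 = 0" "\<forall>z\<in>ball 0 1. cmod (f z) < 1"
  obtains h where "h holomorphic_on ball 0 1" "\<forall>z\<in>ball 0 1. cmod (h z) \<le> 1"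
    "\<forall>z\<in>ball 0 1. f z = z * h z"
proof -
  obtain h where h: "h holomorphic_on ball 0 1" "\<And>z. norm z < 1 \<Longrightarrow> f z = z * h z" "deriv f 0 = h 0"
    using Schwarz3[OF assms(1,2)] by metis
  have "cmod (h z) \<le> 1" if z: "z \<in> ball 0 1" for z
  proof (cases "z = 0")
    case True
    then show ?thesis
      using Schwarz_Lemma(2)[OF assms(1,2), of 0] assms(3) h(3) by simp
  next
    case False
    have "cmod (f z) \<le> cmod z"
      using Schwarz_Lemma(1)[OF assms(1,2)] assms(3) z by simp
    then show ?thesis using False h(2)[of z] z by (simp add: norm_mult)
  qed
  then show ?thesis using h that by auto
qed

text \<open>One step of Schur's algorithm: the automorphism of the disc that moves \<open>w 0\<close> to 0, followed by
  the Schwarz lemma. The relation is stated without a quotient so that it also covers the constants \<open>w\<close> of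
  modulus 1, for which the quotient is \<open>0 / 0\<close> and \<open>v = 0\<close> will do.\<close>

lemma schur_step:
  assumes hol: "w holomorphic_on ball 0 1" and le: "\<forall>z\<in>ball 0 1. cmod (w z) \<le> 1"
  obtains v where "v holomorphic_on ball 0 1" "\<forall>z\<in>ball 0 1. cmod (v z) \<le> 1"
    "\<forall>z\<in>ball 0 1. w z * (1 + cnj (w 0) * (z * v z)) = w 0 + z * v z"
proof (cases "\<exists>\<xi>\<in>ball 0 1. cmod (w \<xi>) = 1")
  case True
  then obtain \<xi> where \<xi>: "\<xi> \<in> ball 0 1" "cmod (w \<xi>) = 1" by blast
  have "w constant_on ball 0 1"
    by (rule maximum_modulus_principle[OF hol open_ball connected_ball open_ball order_refl \<xi>(1)])
       (use le \<xi>(2) in auto)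
  then obtain k where "\<And>z. z \<in> ball 0 1 \<Longrightarrow> w z = k"
    unfolding constant_on_def by blast
  then show ?thesis by (intro that[of "\<lambda>_. 0"]) auto
next
  case False
  define c where "c = w 0"
  have lt: "cmod (w z) < 1" if "z \<in> ball 0 1" for z
    using False le that by (meson less_le)
  have c1: "cmod c < 1" using lt[of 0] by (simp add: c_def)
  have den: "1 - cnj c * w z \<noteq> 0" if "z \<in> ball 0 1" for z
  proof
    assume "1 - cnj c * w z = 0"
    then have "cmod (cnj c * w z) = 1" by simp
    moreover have "cmod c * cmod (w z) < 1 * 1"
      by (rule mult_strict_mono) (use c1 lt[OF that] in auto)
    ultimately show False by (simp add: norm_mult)
  qed
  define f where "f z = (w z - c) / (1 - cnj c * w z)" for z
  have f_hol: "f holomorphic_on ball 0 1"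
    unfolding f_def by (intro holomorphic_intros hol den)
  have f_0: "f 0 = 0" by (simp add: f_def c_def)
  have f_less: "\<forall>z\<in>ball 0 1. cmod (f z) < 1"
  proof
    fix z :: complex
    assume z: "z \<in> ball 0 1"
    have "(cmod (1 - cnj c * w z))\<^sup>2 - (cmod (w z - c))\<^sup>2 = (1 - (cmod c)\<^sup>2) * (1 - (cmod (w z))\<^sup>2)"
      unfolding cmod_power2 by (simp add: power2_eq_square algebra_simps)
    also have "\<dots> > 0"
      using c1 lt[OF z] by (intro mult_pos_pos) (auto simp: power_less_one_iff)
    finally have "(cmod (w z - c))\<^sup>2 < (cmod (1 - cnj c * w z))\<^sup>2" by simp
    then have "cmod (w z - c) < cmod (1 - cnj c * w z)"
      by (rule power2_less_imp_less) auto
    then show "cmod (f z) < 1" using den[OF z] by (simp add: f_def norm_divide)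
  qed
  obtain v where v: "v holomorphic_on ball 0 1" "\<forall>z\<in>ball 0 1. cmod (v z) \<le> 1"
    "\<forall>z\<in>ball 0 1. f z = z * v z"
    by (rule schwarz_quotient[OF f_hol f_0 f_less])
  have "w z * (1 + cnj c * (z * v z)) = c + z * v z" if z: "z \<in> ball 0 1" for z
    unfolding v(3)[rule_format, OF z, symmetric] f_def using den[OF z] by (simp add: field_simps)
  then show ?thesis using that[of v] v unfolding c_def by blast
qed

lemma fps_expansion_ball:
  assumes "f holomorphic_on ball 0 1"
  shows "f has_fps_expansion fps_expansion f 0"
  using assms by (intro has_fps_expansion_fps_expansion[of "ball 0 1"]) auto

lemma has_fps_expansion_eq_on_ball:
  assumes "f has_fps_expansion F" "g has_fps_expansion G" "\<forall>z\<in>ball 0 1. f z = g z"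
  shows "F = (G :: complex fps)"
proof -
  have "eventually (\<lambda>z. f z = g z) (nhds 0)"
    using assms(3) by (intro eventually_nhds_in_open[THEN eventually_mono, of "ball 0 1"]) auto
  then have "g has_fps_expansion F"
    using assms(1) has_fps_expansion_cong by blast
  then show ?thesis using assms(2) fps_expansion_unique_complex by blast
qed

lemma fps_expansion_nth_0: "fps_nth (fps_expansion f 0) 0 = f 0"
  by (simp add: fps_expansion_def)

lemma schur_step_fps:
  assumes "w holomorphic_on ball 0 1" "v holomorphic_on ball 0 1"
    "\<forall>z\<in>ball 0 1. w z * (1 + cnj c * (z * v z)) = c + z * v z"
  shows "fps_expansion w 0 * (1 + fps_const (cnj c) * (fps_X * fps_expansion v 0))
         = fps_const c + fps_X * fps_expansion v 0"
proof (rule has_fps_expansion_eq_on_ball[OF _ _ assms(3)])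
  note W = fps_expansion_ball[OF assms(1)] and V = fps_expansion_ball[OF assms(2)]
  note zV = has_fps_expansion_mult[OF has_fps_expansion_fps_X V]
  show "(\<lambda>z. w z * (1 + cnj c * (z * v z))) has_fps_expansion
      fps_expansion w 0 * (1 + fps_const (cnj c) * (fps_X * fps_expansion v 0))"
    by (rule has_fps_expansion_mult[OF W has_fps_expansion_add[OF has_fps_expansion_1
          has_fps_expansion_cmult_left[OF zV]]])
  show "(\<lambda>z. c + z * v z) has_fps_expansion fps_const c + fps_X * fps_expansion v 0"
    by (rule has_fps_expansion_add[OF has_fps_expansion_const zV])
qed

lemma schur_step_coeffs:
  assumes "W * (1 + fps_const (cnj c) * (fps_X * V)) = fps_const c + fps_X * V"
  defines "d \<equiv> 1 - c * cnj c"
  shows "fps_nth W 0 = c" "fps_nth W 1 = d * fps_nth V 0"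
    "fps_nth W 2 = d * (fps_nth V 1 - cnj c * (fps_nth V 0)\<^sup>2)"
    "fps_nth W 3 = d * (fps_nth V 2 - 2 * cnj c * fps_nth V 0 * fps_nth V 1 + (cnj c)\<^sup>2 * (fps_nth V 0)^3)"
proof -
  have eq: "W + fps_const (cnj c) * (fps_X * (W * V)) = fps_const c + fps_X * V"
    using assms by (simp add: algebra_simps)
  have 0: "fps_nth W 0 = c" using arg_cong[OF eq, of "\<lambda>F. fps_nth F 0"] by simp
  have S: "fps_nth W (Suc n) = fps_nth V n - cnj c * fps_nth (W * V) n" for n
    using arg_cong[OF eq, of "\<lambda>F. fps_nth F (Suc n)"] by (simp add: eq_diff_eq)
  have 1: "fps_nth W 1 = d * fps_nth V 0"
    using S[of 0] by (simp add: 0 d_def algebra_simps)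
  have S2: "fps_nth W 2 = fps_nth V 1 - cnj c * (c * fps_nth V 1 + fps_nth W 1 * fps_nth V 0)"
    using S[of 1] by (simp add: 0 fps_mult_nth numeral_2_eq_2)
  have 2: "fps_nth W 2 = d * (fps_nth V 1 - cnj c * (fps_nth V 0)\<^sup>2)"
    unfolding S2 1 d_def by (simp add: power2_eq_square algebra_simps)
  have S3: "fps_nth W 3 = fps_nth V 2 - cnj c * (c * fps_nth V 2 + fps_nth W 1 * fps_nth V 1
      + fps_nth W 2 * fps_nth V 0)"
    using S[of 2] by (simp add: 0 fps_mult_nth numeral_2_eq_2 numeral_3_eq_3)
  have 3: "fps_nth W 3 = d * (fps_nth V 2 - 2 * cnj c * fps_nth V 0 * fps_nth V 1 + (cnj c)\<^sup>2 * (fps_nth V 0)^3)"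
    unfolding S3 2 1 d_def by (simp add: power2_eq_square power3_eq_cube algebra_simps)
  show "fps_nth W 0 = c" "fps_nth W 1 = d * fps_nth V 0"
    "fps_nth W 2 = d * (fps_nth V 1 - cnj c * (fps_nth V 0)\<^sup>2)"
    "fps_nth W 3 = d * (fps_nth V 2 - 2 * cnj c * fps_nth V 0 * fps_nth V 1 + (cnj c)\<^sup>2 * (fps_nth V 0)^3)"
    by fact+
qed

text \<open>Three Schur steps; the parameters are the values at 0 of \<open>w\<close> and of the three successive
  Schur transforms.\<close>

lemma schur_parameters:
  assumes hol: "w holomorphic_on ball 0 1" and le: "\<forall>z\<in>ball 0 1. cmod (w z) \<le> 1"
  defines "W \<equiv> fps_expansion w 0"
  obtains c x y u t e g :: complex where
    "cmod c \<le> 1" "cmod x \<le> 1" "cmod y \<le> 1" "cmod u \<le> 1"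
    "t = 1 - c * cnj c" "e = 1 - x * cnj x" "g = 1 - y * cnj y"
    "fps_nth W 0 = c" "fps_nth W 1 = t * x" "fps_nth W 2 = t * (e * y - cnj c * x\<^sup>2)"
    "fps_nth W 3 = t * (e * (g * u - cnj x * y\<^sup>2 - 2 * cnj c * x * y) + (cnj c)\<^sup>2 * x^3)"
proof -
  obtain w1 where w1: "w1 holomorphic_on ball 0 1" "\<forall>z\<in>ball 0 1. cmod (w1 z) \<le> 1"
    "\<forall>z\<in>ball 0 1. w z * (1 + cnj (w 0) * (z * w1 z)) = w 0 + z * w1 z"
    by (rule schur_step[OF hol le])
  obtain w2 where w2: "w2 holomorphic_on ball 0 1" "\<forall>z\<in>ball 0 1. cmod (w2 z) \<le> 1"
    "\<forall>z\<in>ball 0 1. w1 z * (1 + cnj (w1 0) * (z * w2 z)) = w1 0 + z * w2 z"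
    by (rule schur_step[OF w1(1,2)])
  obtain w3 where w3: "w3 holomorphic_on ball 0 1" "\<forall>z\<in>ball 0 1. cmod (w3 z) \<le> 1"
    "\<forall>z\<in>ball 0 1. w2 z * (1 + cnj (w2 0) * (z * w3 z)) = w2 0 + z * w3 z"
    by (rule schur_step[OF w2(1,2)])
  note W = schur_step_coeffs[OF schur_step_fps[OF hol w1(1,3)], simplified]
  note W1 = schur_step_coeffs[OF schur_step_fps[OF w1(1) w2(1,3)], simplified]
  note W2 = schur_step_coeffs[OF schur_step_fps[OF w2(1) w3(1,3)], simplified]
  show ?thesis
  proof (rule that[of "w 0" "w1 0" "w2 0" "w3 0", OF _ _ _ _ refl refl refl])
    show "cmod (w 0) \<le> 1" "cmod (w1 0) \<le> 1" "cmod (w2 0) \<le> 1" "cmod (w3 0) \<le> 1"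
      using le w1(2) w2(2) w3(2) by simp_all
    show "fps_nth W 0 = w 0" "fps_nth W 1 = (1 - w 0 * cnj (w 0)) * w1 0"
      using W by (simp_all add: W_def fps_expansion_nth_0)
    show "fps_nth W 2 = (1 - w 0 * cnj (w 0)) * ((1 - w1 0 * cnj (w1 0)) * w2 0 - cnj (w 0) * (w1 0)\<^sup>2)"
      using W W1 by (simp add: W_def fps_expansion_nth_0)
    show "fps_nth W 3 = (1 - w 0 * cnj (w 0)) * ((1 - w1 0 * cnj (w1 0)) *
       ((1 - w2 0 * cnj (w2 0)) * w3 0 - cnj (w1 0) * (w2 0)\<^sup>2 - 2 * cnj (w 0) * w1 0 * w2 0)
         + (cnj (w 0))\<^sup>2 * (w1 0)^3)"
      using W W1 W2 by (simp add: W_def fps_expansion_nth_0 algebra_simps)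
  qed
qed

section \<open>Functions with positive real part\<close>

text \<open>The Cayley transform \<open>(p - 1) / (p + 1)\<close> maps the disc to itself and vanishes at 0.\<close>

lemma caratheodory_schwarz:
  assumes hol: "p holomorphic_on ball 0 1" and p0: "p 0 = 1" and pos: "\<forall>z\<in>ball 0 1. Re (p z) > 0"
  obtains w where "w holomorphic_on ball 0 1" "\<forall>z\<in>ball 0 1. cmod (w z) \<le> 1"
    "\<forall>z\<in>ball 0 1. p z * (1 - z * w z) = 1 + z * w z"
proof -
  define f where "f z = (p z - 1) / (p z + 1)" for z
  have den: "p z + 1 \<noteq> 0" if "z \<in> ball 0 1" for z
    using pos[rule_format, OF that] by (auto simp: complex_eq_iff)
  have f_hol: "f holomorphic_on ball 0 1"
    unfolding f_def by (intro holomorphic_intros hol den)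
  have f_0: "f 0 = 0" by (simp add: f_def p0)
  have f_less: "\<forall>z\<in>ball 0 1. cmod (f z) < 1"
  proof
    fix z :: complex
    assume z: "z \<in> ball 0 1"
    have "(cmod (p z + 1))\<^sup>2 - (cmod (p z - 1))\<^sup>2 = 4 * Re (p z)"
      unfolding cmod_power2 by (simp add: power2_eq_square algebra_simps)
    moreover have "Re (p z) > 0" using pos z by blast
    ultimately have "(cmod (p z - 1))\<^sup>2 < (cmod (p z + 1))\<^sup>2" by linarith
    then have "cmod (p z - 1) < cmod (p z + 1)"
      by (rule power2_less_imp_less) auto
    then show "cmod (f z) < 1" using den[OF z] by (simp add: f_def norm_divide)
  qed
  obtain w where w: "w holomorphic_on ball 0 1" "\<forall>z\<in>ball 0 1. cmod (w z) \<le> 1"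
    "\<forall>z\<in>ball 0 1. f z = z * w z"
    by (rule schwarz_quotient[OF f_hol f_0 f_less])
  have "p z * (1 - z * w z) = 1 + z * w z" if z: "z \<in> ball 0 1" for z
    unfolding w(3)[rule_format, OF z, symmetric] f_def using den[OF z] by (simp add: field_simps)
  then show ?thesis using that[of w] w by blast
qed

lemma caratheodory_coeffs:
  assumes "p holomorphic_on ball 0 1" "w holomorphic_on ball 0 1"
    and pw: "\<forall>z\<in>ball 0 1. p z * (1 - z * w z) = 1 + z * w z"
  defines "P \<equiv> fps_nth (fps_expansion p 0)" and "W \<equiv> fps_nth (fps_expansion w 0)"
  shows "P 1 = 2 * W 0" "P 2 = 2 * (W 1 + (W 0)\<^sup>2)" "P 3 = 2 * (W 2 + 2 * W 0 * W 1 + (W 0)^3)"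
    "P 4 = 2 * (W 3 + 2 * W 0 * W 2 + (W 1)\<^sup>2 + 3 * (W 0)\<^sup>2 * W 1 + (W 0)^4)"
proof -
  define P' W' where "P' = fps_expansion p 0" and "W' = fps_expansion w 0"
  note P = fps_expansion_ball[OF assms(1), folded P'_def] and W = fps_expansion_ball[OF assms(2), folded W'_def]
  note zW = has_fps_expansion_mult[OF has_fps_expansion_fps_X W]
  have "P' * (1 - fps_X * W') = 1 + fps_X * W'"
    by (rule has_fps_expansion_eq_on_ball[OF has_fps_expansion_mult[OF P
            has_fps_expansion_diff[OF has_fps_expansion_1 zW]]
          has_fps_expansion_add[OF has_fps_expansion_1 zW] pw])
  then have eq: "P' = 1 + fps_X * W' + fps_X * (P' * W')"
    by (simp add: algebra_simps)
  have 0: "P 0 = 1" using arg_cong[OF eq, of "\<lambda>F. fps_nth F 0"] by (simp add: P_def P'_def)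
  have S: "P (Suc n) = W n + (\<Sum>i=0..n. P i * W (n - i))" for n
  proof -
    have "P (Suc n) = W n + fps_nth (P' * W') n"
      using arg_cong[OF eq, of "\<lambda>F. fps_nth F (Suc n)"] by (simp add: P_def P'_def W_def W'_def)
    then show ?thesis by (simp add: fps_mult_nth P_def P'_def W_def W'_def)
  qed
  show 1: "P 1 = 2 * W 0"
    using S[of 0] 0 by simp
  show 2: "P 2 = 2 * (W 1 + (W 0)\<^sup>2)"
    using S[of 1] 0 1 by (simp add: numeral_2_eq_2 power2_eq_square)
  show 3: "P 3 = 2 * (W 2 + 2 * W 0 * W 1 + (W 0)^3)"
    using S[of 2] 0 1 2 by (simp add: numeral_2_eq_2 numeral_3_eq_3 algebra_simps)
  show "P 4 = 2 * (W 3 + 2 * W 0 * W 2 + (W 1)\<^sup>2 + 3 * (W 0)\<^sup>2 * W 1 + (W 0)^4)"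
    using S[of 3] 0 1 2 3 by (simp add: eval_nat_numeral algebra_simps)
qed

section \<open>Starlike functions and their inverses\<close>

text \<open>The singularity of \<open>z f' / f\<close> at 0 is removed by cancelling \<open>z\<close>: with \<open>f z = z h z\<close> the quotient
  is \<open>f' / h\<close>, and \<open>h\<close> has no zeros because \<open>f\<close> vanishes only at 0.\<close>

lemma starlike_quotient:
  assumes "f \<in> starlike_functions"
  obtains p where "p holomorphic_on ball 0 1" "p 0 = 1" "\<forall>z\<in>ball 0 1. Re (p z) > 0"
    "\<forall>z\<in>ball 0 1. z * deriv f z = p z * f z"
proof -
  have f: "f holomorphic_on ball 0 1" "f 0 = 0" "deriv f 0 = 1"
    and pos: "\<And>z. z \<in> ball 0 1 \<Longrightarrow> Re (if z = 0 then 1 else z * deriv f z / f z) > 0"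
    using assms by (auto simp: starlike_functions_def normalized_analytic_def)
  obtain h where h: "h holomorphic_on ball 0 1" "\<And>z. norm z < 1 \<Longrightarrow> f z = z * h z" "deriv f 0 = h 0"
    using Schwarz3[OF f(1,2)] by metis
  have h0: "h z \<noteq> 0" if "z \<in> ball 0 1" for z
    using pos[OF that] h(2)[of z] h(3) f(3) that by (auto split: if_splits)
  define p where "p z = deriv f z / h z" for z
  have eq: "p z = (if z = 0 then 1 else z * deriv f z / f z)" if "z \<in> ball 0 1" for z
    using h(2)[of z] h(3) f(3) that by (simp add: p_def)
  have hol: "p holomorphic_on ball 0 1"
    unfolding p_def by (intro holomorphic_intros f(1) h(1) h0 open_ball)
  show ?thesis
  proof (rule that[OF hol])
    show "p 0 = 1" by (simp add: p_def h(3)[symmetric] f(3))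
    show "\<forall>z\<in>ball 0 1. Re (p z) > 0" using pos eq by simp
    show "\<forall>z\<in>ball 0 1. z * deriv f z = p z * f z"
      using h(2) h0 by (simp add: p_def)
  qed
qed

lemma starlike_coeffs:
  fixes F P :: "complex fps"
  assumes eq: "fps_X * fps_deriv F = P * F" and F: "fps_nth F 0 = 0" "fps_nth F 1 = 1"
  defines "p \<equiv> fps_nth P"
  shows "fps_nth F 2 = p 1" "fps_nth F 3 = (p 2 + (p 1)\<^sup>2) / 2"
    "fps_nth F 4 = p 3 / 3 + p 1 * p 2 / 2 + (p 1)^3 / 6"
    "fps_nth F 5 = p 4 / 4 + p 1 * p 3 / 3 + (p 2)\<^sup>2 / 8 + (p 1)\<^sup>2 * p 2 / 4 + (p 1)^4 / 24"
proof -
  have S: "of_nat (Suc n) * fps_nth F (Suc n) = (\<Sum>i=0..Suc n. p i * fps_nth F (Suc n - i))" for n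
  proof -
    have "of_nat (Suc n) * fps_nth F (Suc n) = fps_nth (P * F) (Suc n)"
      using arg_cong[OF eq, of "\<lambda>F. fps_nth F (Suc n)"] by simp
    then show ?thesis by (simp only: fps_mult_nth p_def)
  qed
  have 0: "p 0 = 1" using S[of 0] F by simp
  show 2: "fps_nth F 2 = p 1"
    using S[of 1] F 0 by (simp add: numeral_2_eq_2)
  show 3: "fps_nth F 3 = (p 2 + (p 1)\<^sup>2) / 2"
    using S[of 2] F 0 2 by (simp add: numeral_2_eq_2 numeral_3_eq_3 field_simps)
  have "3 * fps_nth F 4 = p 3 + p 2 * fps_nth F 2 + p 1 * fps_nth F 3"
    using S[of 3] F 0 by (simp add: eval_nat_numeral algebra_simps)
  then show 4: "fps_nth F 4 = p 3 / 3 + p 1 * p 2 / 2 + (p 1)^3 / 6"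
    unfolding 2 3 by (simp add: field_simps power2_eq_square power3_eq_cube)
  have "4 * fps_nth F 5 = p 4 + p 3 * fps_nth F 2 + p 2 * fps_nth F 3 + p 1 * fps_nth F 4"
    using S[of 4] F 0 by (simp add: eval_nat_numeral algebra_simps)
  then have 5: "fps_nth F 5 = (p 4 + p 3 * fps_nth F 2 + p 2 * fps_nth F 3 + p 1 * fps_nth F 4) / 4"
    by (simp add: field_simps)
  show "fps_nth F 5 = p 4 / 4 + p 1 * p 3 / 3 + (p 2)\<^sup>2 / 8 + (p 1)\<^sup>2 * p 2 / 4 + (p 1)^4 / 24"
    unfolding 5 2 3 4 by (simp add: field_simps power2_eq_square power3_eq_cube power4_eq_xxxx)
qed

lemma reversion_coeffs:
  fixes F G :: "complex fps"
  assumes eq: "F oo G = fps_X" and F: "fps_nth F 0 = 0" "fps_nth F 1 = 1" and G: "fps_nth G 0 = 0"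
  defines "a \<equiv> fps_nth F"
  shows "fps_nth G 1 = 1" "fps_nth G 2 = - a 2" "fps_nth G 3 = 2 * (a 2)\<^sup>2 - a 3"
    "fps_nth G 4 = - 5 * (a 2)^3 + 5 * a 2 * a 3 - a 4"
    "fps_nth G 5 = 14 * (a 2)^4 - 21 * (a 2)\<^sup>2 * a 3 + 6 * a 2 * a 4 + 3 * (a 3)\<^sup>2 - a 5"
proof -
  have S: "(\<Sum>i=0..n. a i * fps_nth (G ^ i) n) = (if n = 1 then 1 else 0)" for n
    using arg_cong[OF eq, of "\<lambda>F. fps_nth F n"] by (simp add: fps_compose_nth a_def)
  have a: "a 0 = 0" "a (Suc 0) = 1" using F by (simp_all add: a_def)
  show 1: "fps_nth G 1 = 1" using S[of 1] a G by simp
  show 2: "fps_nth G 2 = - a 2"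
    using S[of 2] a G 1 by (simp add: eval_nat_numeral fps_mult_nth eq_neg_iff_add_eq_0 add.commute)
  show 3: "fps_nth G 3 = 2 * (a 2)\<^sup>2 - a 3"
    using S[of 3] a G 1 2 by (simp add: eval_nat_numeral fps_mult_nth) (simp add: algebra_simps eq_neg_iff_add_eq_0)
  show 4: "fps_nth G 4 = - 5 * (a 2)^3 + 5 * a 2 * a 3 - a 4"
    using S[of 4] a G 1 2 3 by (simp add: eval_nat_numeral fps_mult_nth) (simp add: algebra_simps eq_neg_iff_add_eq_0)
  show "fps_nth G 5 = 14 * (a 2)^4 - 21 * (a 2)\<^sup>2 * a 3 + 6 * a 2 * a 4 + 3 * (a 3)\<^sup>2 - a 5"
    using S[of 5] a G 1 2 3 4 by (simp add: eval_nat_numeral fps_mult_nth) (simp add: algebra_simps eq_neg_iff_add_eq_0)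
qed

lemma hankel_det_3_1:
  "hankel_det 3 1 G = fps_nth G 1 * (fps_nth G 3 * fps_nth G 5 - (fps_nth G 4)\<^sup>2)
     - fps_nth G 2 * (fps_nth G 2 * fps_nth G 5 - fps_nth G 3 * fps_nth G 4)
     + fps_nth G 3 * (fps_nth G 2 * fps_nth G 4 - (fps_nth G 3)\<^sup>2)"
proof -
  have det2: "det A = A $$ (0,0) * A $$ (1,1) - A $$ (0,1) * A $$ (1,0)" if "A \<in> carrier_mat 2 2" for A :: "complex mat"
    using that by (subst laplace_expansion_row[OF that, of 0])
      (auto simp: numeral_2_eq_2 cofactor_def det_single mat_delete_def)
  define A where "A = mat 3 3 (\<lambda>(i, j). fps_nth G (1 + i + j))"
  have A: "A \<in> carrier_mat 3 3" by (simp add: A_def)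
  have m: "mat_delete A 0 j \<in> carrier_mat 2 2" for j
    by (simp add: A_def mat_delete_def)
  have "hankel_det 3 1 G = (\<Sum>j<3. A $$ (0, j) * cofactor A 0 j)"
    unfolding hankel_det_def A_def[symmetric] by (rule laplace_expansion_row[OF A]) simp
  also have "\<dots> = (\<Sum>j<3. A $$ (0, j) * ((-1) ^ j * det (mat_delete A 0 j)))"
    by (simp add: cofactor_def)
  finally show ?thesis
    unfolding det2[OF m]
    by (simp add: A_def mat_delete_def eval_nat_numeral lessThan_Suc algebra_simps)
qed

lemma hankel_det_inverse:
  assumes f: "f \<in> normalized_analytic" and p: "p holomorphic_on ball 0 1"
    and fp: "\<forall>z\<in>ball 0 1. z * deriv f z = p z * f z"
    and g: "local_inverse f g"
  defines "P \<equiv> fps_nth (fps_expansion p 0)"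
  shows "hankel_det 3 1 (fps_expansion g 0) = hankel_from_quotient (P 1) (P 2) (P 3) (P 4)"
proof -
  have f': "f holomorphic_on ball 0 1" "f 0 = 0" "deriv f 0 = 1"
    using f by (auto simp: normalized_analytic_def)
  define F G where "F = fps_expansion f 0" and "G = fps_expansion g 0"
  have F: "f has_fps_expansion F" unfolding F_def by (rule fps_expansion_ball[OF f'(1)])
  have G: "g has_fps_expansion G"
    using g unfolding G_def local_inverse_def by (blast intro: analytic_at_imp_has_fps_expansion_0)
  have F01: "fps_nth F 0 = 0" "fps_nth F 1 = 1"
    using f' by (simp_all add: F_def fps_expansion_def)
  have G0: "fps_nth G 0 = 0"
    using g by (simp add: G_def fps_expansion_nth_0 local_inverse_def)
  have "fps_X * fps_deriv F = fps_expansion p 0 * F"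
    by (rule has_fps_expansion_eq_on_ball[OF has_fps_expansion_mult[OF has_fps_expansion_fps_X
            has_fps_expansion_deriv[OF F]] has_fps_expansion_mult[OF fps_expansion_ball[OF p] F] fp])
  note a = starlike_coeffs[OF this F01, folded P_def]
  have "(f \<circ> g) has_fps_expansion (F oo G) \<longleftrightarrow> (\<lambda>w. w) has_fps_expansion (F oo G)"
    by (rule has_fps_expansion_cong) (use g in \<open>simp_all add: local_inverse_def\<close>)
  moreover have "(f \<circ> g) has_fps_expansion (F oo G)"
    by (rule has_fps_expansion_compose[OF F G G0])
  ultimately have "F oo G = fps_X"
    using fps_expansion_unique_complex has_fps_expansion_fps_X by blast
  note A = reversion_coeffs[OF this F01 G0]
  show ?thesis
    unfolding hankel_det_3_1 G_def[symmetric] A a hankel_from_quotient_def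
    by (simp add: field_simps eval_nat_numeral)
qed

section \<open>The Koebe function and the sharp bound\<close>

lemma koebe_quotient:
  assumes "z \<in> ball 0 1"
  shows "z * deriv koebe z = (1 + z) / (1 - z) * koebe z"
proof -
  have z: "1 - z \<noteq> 0" using assms by auto
  have "(koebe has_field_derivative (1 + z) / (1 - z)^3) (at z)"
    unfolding koebe_def[abs_def] using z
    by (auto intro!: derivative_eq_intros simp: divide_simps) (simp add: eval_nat_numeral algebra_simps)
  then have "deriv koebe z = (1 + z) / (1 - z)^3" by (rule DERIV_imp_deriv)
  then show ?thesis using z by (simp add: koebe_def divide_simps eval_nat_numeral)
qed

lemma koebe_starlike: "koebe \<in> starlike_functions"
proof -
  have "koebe holomorphic_on ball 0 1"
    unfolding koebe_def[abs_def] by (intro holomorphic_intros) auto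
  moreover have "deriv koebe 0 = 1"
  proof -
    have "(koebe has_field_derivative 1) (at 0)"
      unfolding koebe_def[abs_def] by (auto intro!: derivative_eq_intros)
    then show ?thesis by (rule DERIV_imp_deriv)
  qed
  moreover have "Re (if z = 0 then 1 else z * deriv koebe z / koebe z) > 0" if z: "z \<in> ball 0 1" for z
  proof (cases "z = 0")
    case False
    have z1: "1 - z \<noteq> 0" using z by auto
    then have "koebe z \<noteq> 0" using False by (simp add: koebe_def)
    then have "z * deriv koebe z / koebe z = (1 + z) / (1 - z)"
      by (simp add: koebe_quotient[OF z])
    moreover have "Re ((1 + z) / (1 - z)) = (1 - (cmod z)\<^sup>2) / (cmod (1 - z))\<^sup>2"
      unfolding Re_divide' cmod_power2 by (simp add: power2_eq_square algebra_simps)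
    moreover have "1 - (cmod z)\<^sup>2 > 0" using z by (simp add: power_less_one_iff)
    ultimately show ?thesis using False z1 by simp
  qed simp
  ultimately show ?thesis
    by (simp add: starlike_functions_def normalized_analytic_def koebe_def)
qed

theorem theorem2p1:
  shows "(\<forall>f \<in> starlike_functions. \<forall>g. local_inverse f g \<longrightarrow>
            cmod (hankel_det 3 1 (fps_expansion g 0)) \<le> 1) \<and>
         koebe \<in> starlike_functions \<and>
         (\<exists>g. local_inverse koebe g \<and> cmod (hankel_det 3 1 (fps_expansion g 0)) = 1)"
proof (intro conjI ballI allI impI)
  fix f g
  assume f: "f \<in> starlike_functions" and g: "local_inverse f g"
  then have norm: "f \<in> normalized_analytic" by (simp add: starlike_functions_def)
  obtain p where p: "p holomorphic_on ball 0 1" "p 0 = 1" "\<forall>z\<in>ball 0 1. Re (p z) > 0"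
    "\<forall>z\<in>ball 0 1. z * deriv f z = p z * f z"
    by (rule starlike_quotient[OF f])
  obtain w where w: "w holomorphic_on ball 0 1" "\<forall>z\<in>ball 0 1. cmod (w z) \<le> 1"
    "\<forall>z\<in>ball 0 1. p z * (1 - z * w z) = 1 + z * w z"
    by (rule caratheodory_schwarz[OF p(1-3)])
  note P = caratheodory_coeffs[OF p(1) w(1,3)]
  obtain c x y u t e s where bounds: "cmod c \<le> 1" "cmod x \<le> 1" "cmod y \<le> 1" "cmod u \<le> 1"
    and tes: "t = 1 - c * cnj c" "e = 1 - x * cnj x" "s = 1 - y * cnj y"
    and W: "fps_nth (fps_expansion w 0) 0 = c" "fps_nth (fps_expansion w 0) 1 = t * x"
      "fps_nth (fps_expansion w 0) 2 = t * (e * y - cnj c * x\<^sup>2)"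
      "fps_nth (fps_expansion w 0) 3
        = t * (e * (s * u - cnj x * y\<^sup>2 - 2 * cnj c * x * y) + (cnj c)\<^sup>2 * x^3)"
    by (rule schur_parameters[OF w(1,2)])
  show "cmod (hankel_det 3 1 (fps_expansion g 0)) \<le> 1"
    unfolding hankel_det_inverse[OF norm p(1,4) g] P W tes by (rule hankel_schur_bound[OF bounds])
next
  show "koebe \<in> starlike_functions" by (rule koebe_starlike)
next
  have norm: "koebe \<in> normalized_analytic"
    using koebe_starlike by (simp add: starlike_functions_def)
  then obtain g where g: "local_inverse koebe g" using local_inverse_exists by blast
  define p where "p z = (1 + z) / (1 - z)" for z :: complex
  have p: "p holomorphic_on ball 0 1"
    unfolding p_def by (intro holomorphic_intros) auto
  \<comment> \<open>For the Koebe function \<open>w\<close> is the constant 1, so that \<open>p\<^sub>1 = p\<^sub>2 = p\<^sub>3 = p\<^sub>4 = 2\<close>.\<close>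
  have W: "fps_expansion (\<lambda>_. 1) 0 = (1 :: complex fps)"
    by (rule fps_expansion_eqI) simp
  have pw: "\<forall>z\<in>ball 0 1. p z * (1 - z * 1) = 1 + z * 1"
    by (auto simp: p_def)
  note P = caratheodory_coeffs[OF p holomorphic_on_const pw, unfolded W]
  have koebe_eq: "\<forall>z\<in>ball 0 1. z * deriv koebe z = p z * koebe z"
    using koebe_quotient by (simp add: p_def)
  have "hankel_det 3 1 (fps_expansion g 0) = 1"
    unfolding hankel_det_inverse[OF norm p koebe_eq g] P by (simp add: hankel_from_quotient_def)
  then show "\<exists>g. local_inverse koebe g \<and> cmod (hankel_det 3 1 (fps_expansion g 0)) = 1"
    using g by auto
qed

end
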